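(* Assume the anisotropy function $\gamma$ satisfies $\gamma(-\boldsymbol n)<3\,\gamma(\boldsymbol n)$ for all $\boldsymbol n\in\mathbb S^1$. Then, when $k$ is taken sufficiently large (i.e. there is a function $k_0:\mathbb S^1\to[0,\infty)$ depending only on $\gamma$ such that the following holds for every $k:\mathbb S^1\to\mathbb R$ with $k\ge k_0$ pointwise on $\mathbb S^1$), every sequence of solutions $(\boldsymbol X^{m+1},\mu^{m+1},c_l^{m+1},c_r^{m+1})$, $m=0,1,\ldots,K-1$, of the fully discrete scheme (S) described in the context satisfies, for each $m$, $$\frac{W(\boldsymbol X^{m+1})-W(\boldsymbol X^m)}{\Delta t}+\big\langle|\mu_\rho^{m+1}|^2,\,|\boldsymbol X_\rho^m|^{-1}\big\rangle+\frac1\eta\left[\Big(\frac{c_r^{m+1}-c_r^m}{\Delta t}\Big)^2+\Big(\frac{c_l^{m+1}-c_l^m}{\Delta t}\Big)^2\right]\le 0,$$ and consequently $W(\boldsymbol X^{m+1})\le W(\boldsymbol X^m)\le\cdots\le W(\boldsymbol X^0)$.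
   Context: Conventions. For $\boldsymbol v=(v_1,v_2)^T\in\mathbb R^2$, $\boldsymbol v^\perp=(v_2,-v_1)^T$ is the clockwise rotation by $\pi/2$. Constants: $\sigma\in\mathbb R$, $\eta\in(0,\infty)$, $\Delta t>0$, and $K\in\mathbb N$ is the number of time steps. Anisotropy. $\gamma\in C^0(\mathbb R^2)\cap C^2(\mathbb R^2\setminus\{\boldsymbol 0\})$, $\gamma>0$ on $\mathbb R^2\setminus\{\boldsymbol 0\}$, and $\gamma(\lambda\boldsymbol p)=\lambda\gamma(\boldsymbol p)$ for all $\lambda>0$, $\boldsymbol p\in\mathbb R^2$. For $k:\mathbb S^1\to\mathbb R$ and $\boldsymbol n\in\mathbb S^1$, $$\mathbf Z_k(\boldsymbol n)=\gamma(\boldsymbol n)I_2-\boldsymbol n\,\nabla\gamma(\boldsymbol n)^T-\nabla\gamma(\boldsymbol n)\,\boldsymbol n^T+k(\boldsymbol n)\,\boldsymbol n\,\boldsymbol n^T .$$ Substrate. A smooth curve $\boldsymbol r=(r_1,r_2)^T:[0,L_{\rm sub}]\to\mathbb R^2$ parameterized by arclength, $|\boldsymbol r_c|=1$. Finite elements. $\mathbb I=(0,1)$, $q_j=jh$, $h=1/N$, $\mathbb I_j=[q_{j-1},q_j]$, $j=1,\dots,N$. $\mathcal V^h$ is the space of continuous functions on $[0,1]$ that are affine on each $\mathbb I_j$. $\mathcal S^h_{c_l,c_r}=\{\boldsymbol\eta\in[\mathcal V^h]^2:\boldsymbol\eta(0)=\boldsymbol r(c_l),\ \boldsymbol\eta(1)=\boldsymbol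 r(c_r)\}$. Given $c_l^m,c_r^m,c_l^{m+1},c_r^{m+1}\in[0,L_{\rm sub}]$, $$\mathcal V^{m+1}_{c_l,c_r}=\{\boldsymbol\eta\in[\mathcal V^h]^2:\boldsymbol\eta(0)\cdot(\boldsymbol r(c_l^{m+1})-\boldsymbol r(c_l^m))^\perp=0,\ \boldsymbol\eta(1)\cdot(\boldsymbol r(c_r^{m+1})-\boldsymbol r(c_r^m))^\perp=0\}.$$ $\langle\cdot,\cdot\rangle$ is the $L^2$ inner product on $\mathbb I$, and the mass-lumped product is $\langle\boldsymbol v,\boldsymbol w\rangle^h=\frac h2\sum_{j=1}^N[(\boldsymbol v\cdot\boldsymbol w)(q_j^-)+(\boldsymbol v\cdot\boldsymbol w)(q_{j-1}^+)]$ for piecewise continuous functions with possible jumps at nodes (one-sided limits). Discrete curves. $\boldsymbol X^m\in\mathcal S^h_{c_l^m,c_r^m}$ with $|\boldsymbol X^m_\rho|>0$ on each element; $\boldsymbol n^m=-(\boldsymbol X^m_\rho)^\perp/|\boldsymbol X^m_\rho|$; $\boldsymbol n^{m+\frac12}=-\frac{1}{2|\boldsymbol X^m_\rho|}(\boldsymbol X^m_\rho+\boldsymbol X^{m+1}_\rho)^\perp$. For $c\neq c'$ with $\boldsymbol r(c)\ne\boldsymbol r(c')$, $\boldsymbol G(c,c')=\dfrac{(c'-c)(\boldsymbol r(c')-\boldsymbol r(c))}{|\boldsymbol r(c')-\boldsymbol r(c)|^2}$. Energy. $W(\boldsymbol X^m)=\int_0^1\gamma(-(\boldsymbol X^m_\rho)^\perp)\,d\rho-\sigma(c_r^m-c_l^m)$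 (i.e. $\int_{\Gamma^m}\gamma(\boldsymbol n^m)\,ds-\sigma(c_r^m-c_l^m)$ with $\Gamma^m=\boldsymbol X^m([0,1])$). Scheme (S). Given $\boldsymbol X^0$ with $\boldsymbol X^0(0)=\boldsymbol r(c_l^0)$, $\boldsymbol X^0(1)=\boldsymbol r(c_r^0)$, for $m\ge0$ find $c_l^{m+1},c_r^{m+1}\in[0,L_{\rm sub}]$ (with $\boldsymbol r(c_l^{m+1})\neq\boldsymbol r(c_l^m)$ and $\boldsymbol r(c_r^{m+1})\ne\boldsymbol r(c_r^m)$, so that the $\boldsymbol G$ terms are defined), $\boldsymbol X^{m+1}\in\mathcal S^h_{c_l^{m+1},c_r^{m+1}}$ with $\boldsymbol X^{m+1}-\boldsymbol X^m\in\mathcal V^{m+1}_{c_l,c_r}$, and $\mu^{m+1}\in\mathcal V^h$ such that $$\tfrac1{\Delta t}\big\langle(\boldsymbol X^{m+1}-\boldsymbol X^m)\cdot\boldsymbol n^{m+\frac12},\chi^h|\boldsymbol X^m_\rho|\big\rangle^h+\big\langle\mu^{m+1}_\rho,\chi^h_\rho|\boldsymbol X^m_\rho|^{-1}\big\rangle=0\quad\forall\chi^h\in\mathcal V^h,$$ $$\big\langle\mu^{m+1}\boldsymbol n^{m+\frac12},\boldsymbol\zeta^h|\boldsymbol X^m_\rho|\big\rangle^h-\big\langle\mathbf Z_k(\boldsymbol n^m)\boldsymbol X^{m+1}_\rho,\boldsymbol\zeta^h_\rho|\boldsymbol X^m_\rho|^{-1}\big\rangle+\sigma\big[\boldsymbol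 G(c_r^m,c_r^{m+1})\cdot\boldsymbol\zeta^h(1)-\boldsymbol G(c_l^m,c_l^{m+1})\cdot\boldsymbol\zeta^h(0)\big]$$ $$-\tfrac1{\eta\Delta t}\big[(c_r^{m+1}-c_r^m)\boldsymbol G(c_r^m,c_r^{m+1})\cdot\boldsymbol\zeta^h(1)+(c_l^{m+1}-c_l^m)\boldsymbol G(c_l^m,c_l^{m+1})\cdot\boldsymbol\zeta^h(0)\big]=0\quad\forall\boldsymbol\zeta^h\in\mathcal V^{m+1}_{c_l,c_r}.$$ *)

theory Defs
  imports "HOL-Analysis.Analysis"
begin

definition perp :: "real^2 \<Rightarrow> real^2" where
  "perp v = vector [v $ 2, - (v $ 1)]"

definition outer :: "real^2 \<Rightarrow> real^2 \<Rightarrow> real^2^2" where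
  "outer a b = (\<chi> i j. a $ i * b $ j)"

definition grad :: "(real^2 \<Rightarrow> real) \<Rightarrow> real^2 \<Rightarrow> real^2" where
  "grad f x = (THE D. GDERIV f x :> D)"

(* Meant for open S; the matrix field H is the Hessian. *)
definition C2_on :: "(real^2) set \<Rightarrow> (real^2 \<Rightarrow> real) \<Rightarrow> bool" where
  "C2_on S f \<longleftrightarrow>
     (\<exists>H :: real^2 \<Rightarrow> real^2^2.
        (\<forall>x\<in>S. GDERIV f x :> grad f x \<and> (grad f has_derivative (\<lambda>h. H x *v h)) (at x)) \<and>
        continuous_on S H)"

definition anisotropy :: "(real^2 \<Rightarrow> real) \<Rightarrow> bool" where
  "anisotropy \<gamma> \<longleftrightarrow>
     continuous_on UNIV \<gamma> \<and> C2_on (UNIV - {0}) \<gamma> \<and>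
     (\<forall>p. p \<noteq> 0 \<longrightarrow> 0 < \<gamma> p) \<and>
     (\<forall>c p. 0 < c \<longrightarrow> \<gamma> (c *\<^sub>R p) = c * \<gamma> p)"

definition Zmat :: "(real^2 \<Rightarrow> real) \<Rightarrow> (real^2 \<Rightarrow> real) \<Rightarrow> real^2 \<Rightarrow> real^2^2" where
  "Zmat \<gamma> k n =
     \<gamma> n *\<^sub>R mat 1 - outer n (grad \<gamma> n) - outer (grad \<gamma> n) n + k n *\<^sub>R outer n n"

(* All iterated (one-sided at the endpoints) derivatives exist; meant for a < b. *)
definition smooth_on_interval :: "real \<Rightarrow> real \<Rightarrow> (real \<Rightarrow> real^2) \<Rightarrow> bool" where
  "smooth_on_interval a b f \<longleftrightarrow>
     (\<forall>i. ((\<lambda>g t. vector_derivative g (at t within {a..b})) ^^ i) f differentiable_on {a..b})"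

definition substrate :: "real \<Rightarrow> (real \<Rightarrow> real^2) \<Rightarrow> bool" where
  "substrate L r \<longleftrightarrow>
     0 < L \<and> smooth_on_interval 0 L r \<and>
     (\<forall>c\<in>{0..L}. norm (vector_derivative r (at c within {0..L})) = 1)"

definition node :: "nat \<Rightarrow> nat \<Rightarrow> real" where
  "node N j = real j / real N"

(* Finite element functions are total functions on the reals of which only the
   values on the unit interval are relevant. *)
definition Vh :: "nat \<Rightarrow> (real \<Rightarrow> real) set" where
  "Vh N = {v. continuous_on {0..1} v \<and>
     (\<forall>j\<in>{1..N}. \<exists>a b. \<forall>\<rho>\<in>{node N (j - 1)..node N j}. v \<rho> = a + b * \<rho>)}"

definition Vh2 :: "nat \<Rightarrow> (real \<Rightarrow> real^2) set" where
  "Vh2 N = {v. \<forall>i. (\<lambda>\<rho>. v \<rho> $ i) \<in> Vh N}"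

definition Sh :: "nat \<Rightarrow> (real \<Rightarrow> real^2) \<Rightarrow> real \<Rightarrow> real \<Rightarrow> (real \<Rightarrow> real^2) set" where
  "Sh N r cl cr = {v \<in> Vh2 N. v 0 = r cl \<and> v 1 = r cr}"

(* cl, cr are the old contact points, cl', cr' the new ones. *)
definition Vtest ::
  "nat \<Rightarrow> (real \<Rightarrow> real^2) \<Rightarrow> real \<Rightarrow> real \<Rightarrow> real \<Rightarrow> real \<Rightarrow> (real \<Rightarrow> real^2) set" where
  "Vtest N r cl cr cl' cr' = {v \<in> Vh2 N.
     v 0 \<bullet> perp (r cl' - r cl) = 0 \<and> v 1 \<bullet> perp (r cr' - r cr) = 0}"

(* The weak derivative of a finite element function: piecewise constant, and
   unspecified at the nodes, where neither product below depends on it. *)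
abbreviation D\<rho> :: "(real \<Rightarrow> 'a::real_normed_vector) \<Rightarrow> real \<Rightarrow> 'a" where
  "D\<rho> v \<rho> \<equiv> vector_derivative v (at \<rho>)"

definition ip :: "(real \<Rightarrow> 'a::real_inner) \<Rightarrow> (real \<Rightarrow> 'a) \<Rightarrow> real" where
  "ip v w = integral {0..1} (\<lambda>\<rho>. v \<rho> \<bullet> w \<rho>)"

definition iph :: "nat \<Rightarrow> (real \<Rightarrow> 'a::real_inner) \<Rightarrow> (real \<Rightarrow> 'a) \<Rightarrow> real" where
  "iph N v w = (1 / real N) / 2 *
     (\<Sum>j=1..N. Lim (at_left (node N j)) (\<lambda>\<rho>. v \<rho> \<bullet> w \<rho>)
              + Lim (at_right (node N (j - 1))) (\<lambda>\<rho>. v \<rho> \<bullet> w \<rho>))"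

definition nondegenerate :: "nat \<Rightarrow> (real \<Rightarrow> real^2) \<Rightarrow> bool" where
  "nondegenerate N X \<longleftrightarrow>
     (\<forall>j\<in>{1..N}. \<forall>\<rho>\<in>{node N (j - 1)<..<node N j}. 0 < norm (D\<rho> X \<rho>))"

definition nvec :: "(real \<Rightarrow> real^2) \<Rightarrow> real \<Rightarrow> real^2" where
  "nvec X \<rho> = - (perp (D\<rho> X \<rho>) /\<^sub>R norm (D\<rho> X \<rho>))"

definition nvec_half :: "(real \<Rightarrow> real^2) \<Rightarrow> (real \<Rightarrow> real^2) \<Rightarrow> real \<Rightarrow> real^2" where
  "nvec_half X X' \<rho> = - (1 / (2 * norm (D\<rho> X \<rho>))) *\<^sub>R perp (D\<rho> X \<rho> + D\<rho> X' \<rho>)"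

definition Gvec :: "(real \<Rightarrow> real^2) \<Rightarrow> real \<Rightarrow> real \<Rightarrow> real^2" where
  "Gvec r c c' = ((c' - c) / (norm (r c' - r c))\<^sup>2) *\<^sub>R (r c' - r c)"

definition energy ::
  "(real^2 \<Rightarrow> real) \<Rightarrow> real \<Rightarrow> (real \<Rightarrow> real^2) \<Rightarrow> real \<Rightarrow> real \<Rightarrow> real" where
  "energy \<gamma> \<sigma> X cl cr =
     integral {0..1} (\<lambda>\<rho>. \<gamma> (- perp (D\<rho> X \<rho>))) - \<sigma> * (cr - cl)"

(* One time step from (X, cl, cr) to (X', mu', cl', cr'). *)
definition scheme_step ::
  "(real^2 \<Rightarrow> real) \<Rightarrow> (real^2 \<Rightarrow> real) \<Rightarrow> real \<Rightarrow> real \<Rightarrow> real \<Rightarrow> real \<Rightarrow> (real \<Rightarrow> real^2) \<Rightarrow> nat \<Rightarrow>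
   (real \<Rightarrow> real^2) \<Rightarrow> real \<Rightarrow> real \<Rightarrow>
   (real \<Rightarrow> real^2) \<Rightarrow> (real \<Rightarrow> real) \<Rightarrow> real \<Rightarrow> real \<Rightarrow> bool" where
  "scheme_step \<gamma> k \<sigma> \<eta> \<Delta>t L r N X cl cr X' \<mu>' cl' cr' \<longleftrightarrow>
     cl' \<in> {0..L} \<and> cr' \<in> {0..L} \<and> r cl' \<noteq> r cl \<and> r cr' \<noteq> r cr \<and>
     X' \<in> Sh N r cl' cr' \<and>
     (\<lambda>\<rho>. X' \<rho> - X \<rho>) \<in> Vtest N r cl cr cl' cr' \<and>
     \<mu>' \<in> Vh N \<and>
     (\<forall>\<phi>\<in>Vh N.
        1 / \<Delta>t * iph N (\<lambda>\<rho>. (X' \<rho> - X \<rho>) \<bullet> nvec_half X X' \<rho>) (\<lambda>\<rho>. \<phi> \<rho> * norm (D\<rho> X \<rho>))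
        + ip (D\<rho> \<mu>') (\<lambda>\<rho>. D\<rho> \<phi> \<rho> * inverse (norm (D\<rho> X \<rho>))) = 0) \<and>
     (\<forall>\<zeta>\<in>Vtest N r cl cr cl' cr'.
        iph N (\<lambda>\<rho>. \<mu>' \<rho> *\<^sub>R nvec_half X X' \<rho>) (\<lambda>\<rho>. norm (D\<rho> X \<rho>) *\<^sub>R \<zeta> \<rho>)
        - ip (\<lambda>\<rho>. Zmat \<gamma> k (nvec X \<rho>) *v D\<rho> X' \<rho>)
             (\<lambda>\<rho>. inverse (norm (D\<rho> X \<rho>)) *\<^sub>R D\<rho> \<zeta> \<rho>)
        + \<sigma> * (Gvec r cr cr' \<bullet> \<zeta> 1 - Gvec r cl cl' \<bullet> \<zeta> 0)
        - 1 / (\<eta> * \<Delta>t) *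
            ((cr' - cr) * (Gvec r cr cr' \<bullet> \<zeta> 1) + (cl' - cl) * (Gvec r cl cl' \<bullet> \<zeta> 0)) = 0)"

(* Nondegeneracy is required of X 0, ..., X (K - 1), i.e. exactly of those curves whose
   inverse element lengths enter the scheme. The value mu 0 is unused. *)
definition scheme_solution ::
  "(real^2 \<Rightarrow> real) \<Rightarrow> (real^2 \<Rightarrow> real) \<Rightarrow> real \<Rightarrow> real \<Rightarrow> real \<Rightarrow> real \<Rightarrow> (real \<Rightarrow> real^2) \<Rightarrow> nat \<Rightarrow> nat \<Rightarrow>
   (nat \<Rightarrow> real \<Rightarrow> real^2) \<Rightarrow> (nat \<Rightarrow> real \<Rightarrow> real) \<Rightarrow> (nat \<Rightarrow> real) \<Rightarrow> (nat \<Rightarrow> real) \<Rightarrow> bool" where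
  "scheme_solution \<gamma> k \<sigma> \<eta> \<Delta>t L r N K X \<mu> cl cr \<longleftrightarrow>
     cl 0 \<in> {0..L} \<and> cr 0 \<in> {0..L} \<and> X 0 \<in> Sh N r (cl 0) (cr 0) \<and>
     (\<forall>m<K. nondegenerate N (X m) \<and>
        scheme_step \<gamma> k \<sigma> \<eta> \<Delta>t L r N (X m) (cl m) (cr m)
          (X (Suc m)) (\<mu> (Suc m)) (cl (Suc m)) (cr (Suc m)))"

end

theory Submission
  imports Defs
begin

text \<open>
  Testing the two equations with \<open>\<mu>\<^sup>m\<^sup>+\<^sup>1\<close> and \<open>X\<^sup>m\<^sup>+\<^sup>1 - X\<^sup>m\<close> and eliminating the common mass-lumped term
  reduces the claim to a bound of the surface energy difference by the \<open>Zmat\<close> term. All integrands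
  are constant on the elements and \<open>\<gamma>\<close> is homogeneous, so it suffices to show, for each
  unit vector \<open>n\<close> separately, that \<open>\<gamma> (- perp p) - \<gamma> n \<le> (Zmat \<gamma> k n *v p) \<bullet> (p - perp n)\<close> for
  all \<open>p\<close> once \<open>k n\<close> is large.
\<close>

section \<open>Rotation by a right angle and orthonormal frames in the plane\<close>

lemma perp_component [simp]: "perp v $ 1 = v $ 2" "perp v $ 2 = - (v $ 1)"
  by (simp_all add: perp_def)

lemma vec2_eq_iff: "(x = y) \<longleftrightarrow> x $ 1 = y $ 1 \<and> x $ 2 = y $ 2" for x y :: "real^2"
  by (simp add: vec_eq_iff forall_2)

lemma inner_vec2: "x \<bullet> y = x $ 1 * y $ 1 + x $ 2 * y $ 2" for x y :: "real^2"
  by (simp add: inner_vec_def sum_2)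

lemma perp_perp [simp]: "perp (perp v) = - v"
  by (simp add: vec2_eq_iff)

lemma perp_scaleR: "perp (c *\<^sub>R v) = c *\<^sub>R perp v"
  by (simp add: vec2_eq_iff)

lemma perp_minus: "perp (- v) = - perp v"
  by (simp add: vec2_eq_iff)

lemma perp_add: "perp (v + w) = perp v + perp w"
  by (simp add: vec2_eq_iff)

lemma norm_perp [simp]: "norm (perp v) = norm v"
  by (simp add: norm_eq_sqrt_inner inner_vec2 algebra_simps)

lemma inner_perp_self [simp]: "v \<bullet> perp v = 0" "perp v \<bullet> v = 0"
  by (simp_all add: inner_vec2)

lemma orthonormal_expansion:
  assumes "norm n = 1"
  shows "p = (p \<bullet> perp n) *\<^sub>R perp n + (p \<bullet> n) *\<^sub>R n"
proof -
  have n: "(n $ 1)\<^sup>2 + (n $ 2)\<^sup>2 = 1"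
    using assms by (simp add: norm_eq_1 inner_vec2 power2_eq_square)
  have "(p \<bullet> perp n) * n $ 2 + (p \<bullet> n) * n $ 1 = p $ 1 * ((n $ 1)\<^sup>2 + (n $ 2)\<^sup>2)"
    "(p \<bullet> perp n) * (- n $ 1) + (p \<bullet> n) * n $ 2 = p $ 2 * ((n $ 1)\<^sup>2 + (n $ 2)\<^sup>2)"
    by (simp_all add: inner_vec2 algebra_simps power2_eq_square)
  then show ?thesis
    by (simp add: vec2_eq_iff n)
qed

lemma Zmat_mult:
  "Zmat \<gamma> k n *v p =
     \<gamma> n *\<^sub>R p - (grad \<gamma> n \<bullet> p) *\<^sub>R n - (n \<bullet> p) *\<^sub>R grad \<gamma> n + (k n * (n \<bullet> p)) *\<^sub>R n"
  by (simp add: Zmat_def outer_def vec2_eq_iff matrix_vector_mult_def sum_2 inner_vec2 mat_def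
      algebra_simps)

subsection \<open>The anisotropy function\<close>

context
  fixes \<gamma> :: "real^2 \<Rightarrow> real"
  assumes aniso: "anisotropy \<gamma>"
begin

lemma anisotropy_pos: "p \<noteq> 0 \<Longrightarrow> 0 < \<gamma> p"
  using aniso by (simp add: anisotropy_def)

lemma anisotropy_homogeneous: "0 < c \<Longrightarrow> \<gamma> (c *\<^sub>R p) = c * \<gamma> p"
  using aniso by (simp add: anisotropy_def)

lemma anisotropy_zero: "\<gamma> 0 = 0"
  using anisotropy_homogeneous[of 2 0] by simp

lemma anisotropy_GDERIV: "x \<noteq> 0 \<Longrightarrow> GDERIV \<gamma> x :> grad \<gamma> x"
  using aniso by (auto simp: anisotropy_def C2_on_def)

text \<open>Continuity bounds \<open>\<gamma>\<close> on the compact unit circle, and homogeneity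
  carries the bound along rays. This controls \<open>\<gamma>\<close> far from a given direction,
  where local expansions say nothing.\<close>

lemma anisotropy_linear_growth: "\<exists>M\<ge>0. \<forall>p. \<gamma> p \<le> M * norm p"
proof -
  have "compact (\<gamma> ` sphere 0 1)"
    by (rule compact_continuous_image)
      (use aniso in \<open>auto simp: anisotropy_def intro: continuous_on_subset\<close>)
  then obtain M where M: "\<And>p. p \<in> sphere 0 1 \<Longrightarrow> \<bar>\<gamma> p\<bar> \<le> M"
    by (meson bounded_real compact_imp_bounded image_eqI)
  have "\<gamma> p \<le> max M 0 * norm p" for p
  proof (cases "p = 0")
    case False
    have "\<gamma> p = norm p * \<gamma> (p /\<^sub>R norm p)"
      using False anisotropy_homogeneous[of "norm p" "p /\<^sub>R norm p"] by simp
    also have "\<dots> \<le> norm p * max M 0"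
      using M[of "p /\<^sub>R norm p"] False by (intro mult_left_mono) auto
    finally show ?thesis
      by (simp add: mult.commute)
  qed (simp add: anisotropy_zero)
  then show ?thesis
    by (intro exI[of _ "max M 0"]) auto
qed

text \<open>Euler's identity: the derivative of \<open>\<gamma> (c *\<^sub>R n)\<close> at
  \<open>c = 1\<close> is computed once by the chain rule and once from homogeneity.\<close>

lemma anisotropy_euler:
  assumes "n \<noteq> 0"
  shows "grad \<gamma> n \<bullet> n = \<gamma> n"
proof -
  have "((\<lambda>c. \<gamma> (c *\<^sub>R n)) has_derivative (\<lambda>h. (h *\<^sub>R n) \<bullet> grad \<gamma> n)) (at 1)"
    by (rule has_derivative_compose[where f = "\<lambda>c. c *\<^sub>R n" and g = \<gamma>])
      (use anisotropy_GDERIV[OF assms] in \<open>auto simp: gderiv_def intro!: derivative_eq_intros\<close>)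
  then have "((\<lambda>c. \<gamma> (c *\<^sub>R n)) has_field_derivative (n \<bullet> grad \<gamma> n)) (at 1)"
    by (simp add: has_field_derivative_def mult_commute_abs)
  moreover have "((\<lambda>c. \<gamma> (c *\<^sub>R n)) has_field_derivative \<gamma> n) (at 1)"
  proof (rule has_field_derivative_transform_within_open)
    show "((\<lambda>c. c * \<gamma> n) has_field_derivative \<gamma> n) (at 1)"
      by (auto intro!: derivative_eq_intros)
    show "c * \<gamma> n = \<gamma> (c *\<^sub>R n)" if "c \<in> {0<..}" for c
      using that by (simp add: anisotropy_homogeneous)
  qed auto
  ultimately show ?thesis
    using DERIV_unique by (simp add: inner_commute)
qed

text \<open>A Taylor bound made global along a line. For small \<open>t\<close> the mean value
  theorem applies, together with a Lipschitz bound for the gradient at \<open>n\<close>; for large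
  \<open>t\<close> the linear growth of \<open>\<gamma>\<close> is dominated by
  \<open>t\<^sup>2\<close>.\<close>

lemma anisotropy_second_order_bound:
  assumes n: "norm n = 1" and v: "norm v = 1"
  shows "\<exists>C\<ge>0. \<forall>t. \<gamma> (n + t *\<^sub>R v) \<le> \<gamma> n + t * (v \<bullet> grad \<gamma> n) + C * t\<^sup>2"
proof -
  define g where "g = grad \<gamma> n"
  have "n \<noteq> 0"
    using n by auto
  then obtain H where H: "(grad \<gamma> has_derivative (\<lambda>h. H *v h)) (at n)"
    using aniso unfolding anisotropy_def C2_on_def by (metis DiffI UNIV_I singletonD)
  obtain B where B: "\<And>h. norm (H *v h) \<le> norm h * B"
    using has_derivative_bounded_linear[OF H] bounded_linear.bounded by blast
  \<comment> \<open>Differentiability of the gradient at \<open>n\<close>, with tolerance 1; with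
    the operator bound \<open>B\<close> this yields the Lipschitz constant
    \<open>B + 1\<close>.\<close>
  obtain d where d: "0 < d"
    and lin: "\<And>y. norm (y - n) < d \<Longrightarrow> norm (grad \<gamma> y - grad \<gamma> n - H *v (y - n)) \<le> norm (y - n)"
    using H unfolding has_derivative_at_alt by (metis mult_1 zero_less_one)
  have lip: "norm (grad \<gamma> (n + t *\<^sub>R v) - g) \<le> (B + 1) * \<bar>t\<bar>" if "\<bar>t\<bar> < d" for t
    using lin[of "n + t *\<^sub>R v"] B[of "t *\<^sub>R v"] that v
      norm_triangle_sub[of "grad \<gamma> (n + t *\<^sub>R v) - g" "H *v (t *\<^sub>R v)"]
    by (simp add: g_def algebra_simps)
  have B1: "0 \<le> B + 1"
  proof -
    have "0 \<le> (B + 1) * \<bar>d / 2\<bar>"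
      using lip[of "d / 2"] d by (intro order_trans[OF norm_ge_zero]) auto
    then show ?thesis
      using d by (simp add: zero_le_mult_iff)
  qed
  \<comment> \<open>The bound \<open>d\<close> keeps \<open>lip\<close> available. The bound 1 keeps
    the segment away from the origin, where \<open>\<gamma>\<close> need not be differentiable,
    since \<open>n\<close> and \<open>v\<close> are unit vectors.\<close>
  define e where "e = min d 1"
  have e: "0 < e" "e \<le> d" "e \<le> 1"
    using d by (auto simp: e_def)
  have ne: "n + t *\<^sub>R v \<noteq> 0" if "\<bar>t\<bar> < e" for t
  proof
    assume "n + t *\<^sub>R v = 0"
    then have "norm n = norm (t *\<^sub>R v)"
      by (metis add_eq_0_iff norm_minus_cancel)
    then show False
      using n v that e by simp
  qed
  have deriv: "((\<lambda>t. \<gamma> (n + t *\<^sub>R v)) has_field_derivative (v \<bullet> grad \<gamma> (n + t *\<^sub>R v))) (at t)"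
    if "\<bar>t\<bar> < e" for t
  proof -
    have "((\<lambda>t. \<gamma> (n + t *\<^sub>R v)) has_derivative (\<lambda>h. (h *\<^sub>R v) \<bullet> grad \<gamma> (n + t *\<^sub>R v))) (at t)"
      by (rule has_derivative_compose[where f = "\<lambda>t. n + t *\<^sub>R v" and g = \<gamma>])
        (use anisotropy_GDERIV[OF ne[OF that]] in
          \<open>auto simp: gderiv_def intro!: derivative_eq_intros\<close>)
    then show ?thesis
      by (simp add: has_field_derivative_def mult_commute_abs)
  qed
  have near: "\<gamma> (n + t *\<^sub>R v) \<le> \<gamma> n + t * (v \<bullet> g) + (B + 1) * t\<^sup>2" if t: "\<bar>t\<bar> < e" for t
  proof -
    \<comment> \<open>The weak localization of the intermediate point covers \<open>t = 0\<close>
      and both signs of \<open>t\<close> at once.\<close>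
    have "\<exists>\<xi>. \<bar>\<xi>\<bar> \<le> \<bar>t\<bar> \<and> \<gamma> (n + t *\<^sub>R v) - \<gamma> n = t * (v \<bullet> grad \<gamma> (n + \<xi> *\<^sub>R v))"
    proof (cases "t = 0")
      case True
      then show ?thesis by auto
    next
      case False
      show ?thesis
      proof (cases "0 < t")
        case True
        obtain z where "0 < z" "z < t"
          "\<gamma> (n + t *\<^sub>R v) - \<gamma> (n + 0 *\<^sub>R v) = (t - 0) * (v \<bullet> grad \<gamma> (n + z *\<^sub>R v))"
          using MVT2[of 0 t "\<lambda>t. \<gamma> (n + t *\<^sub>R v)" "\<lambda>t. v \<bullet> grad \<gamma> (n + t *\<^sub>R v)"] deriv t True
          by (smt (verit))
        then show ?thesis
          by (intro exI[of _ z]) auto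
      next
        case neg: False
        then have "t < 0"
          using False by simp
        obtain z where "t < z" "z < 0"
          "\<gamma> (n + 0 *\<^sub>R v) - \<gamma> (n + t *\<^sub>R v) = (0 - t) * (v \<bullet> grad \<gamma> (n + z *\<^sub>R v))"
          using MVT2[of t 0 "\<lambda>t. \<gamma> (n + t *\<^sub>R v)" "\<lambda>t. v \<bullet> grad \<gamma> (n + t *\<^sub>R v)"] deriv t \<open>t < 0\<close>
          by (smt (verit))
        then show ?thesis
          by (intro exI[of _ z]) (auto simp: algebra_simps)
      qed
    qed
    then obtain \<xi> where \<xi>: "\<bar>\<xi>\<bar> \<le> \<bar>t\<bar>"
      "\<gamma> (n + t *\<^sub>R v) - \<gamma> n = t * (v \<bullet> grad \<gamma> (n + \<xi> *\<^sub>R v))"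
      by blast
    have "\<bar>v \<bullet> (grad \<gamma> (n + \<xi> *\<^sub>R v) - g)\<bar> \<le> (B + 1) * \<bar>\<xi>\<bar>"
      using Cauchy_Schwarz_ineq2[of v "grad \<gamma> (n + \<xi> *\<^sub>R v) - g"] lip[of \<xi>] \<xi> t e v by simp
    also have "\<dots> \<le> (B + 1) * \<bar>t\<bar>"
      using B1 \<xi> by (simp add: mult_left_mono)
    finally have "\<bar>t\<bar> * \<bar>v \<bullet> (grad \<gamma> (n + \<xi> *\<^sub>R v) - g)\<bar> \<le> \<bar>t\<bar> * ((B + 1) * \<bar>t\<bar>)"
      by (rule mult_left_mono) simp
    then have "t * (v \<bullet> (grad \<gamma> (n + \<xi> *\<^sub>R v) - g)) \<le> (B + 1) * t\<^sup>2"
      using abs_ge_self[of "t * (v \<bullet> (grad \<gamma> (n + \<xi> *\<^sub>R v) - g))"]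
      unfolding abs_mult power2_eq_square by (simp only: ac_simps abs_mult_self_eq)
    then show ?thesis
      using \<xi>(2) by (simp add: inner_diff_right algebra_simps)
  qed
  obtain M where M: "0 \<le> M" "\<And>p. \<gamma> p \<le> M * norm p"
    using anisotropy_linear_growth by blast
  \<comment> \<open>Since \<open>1 \<le> \<bar>t\<bar> / e\<close> in the far range, the first
    summand absorbs the constant \<open>M\<close> and the second the terms linear in
    \<open>\<bar>t\<bar>\<close>.\<close>
  define C where "C = M / e\<^sup>2 + (M + norm g) / e"
  have far: "\<gamma> (n + t *\<^sub>R v) \<le> \<gamma> n + t * (v \<bullet> g) + C * t\<^sup>2" if t: "e \<le> \<bar>t\<bar>" for t
  proof -
    have "\<gamma> (n + t *\<^sub>R v) \<le> M * (1 + \<bar>t\<bar>)"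
      using M(2)[of "n + t *\<^sub>R v"] norm_triangle_ineq[of n "t *\<^sub>R v"] n v M(1)
        mult_left_mono[of "norm (n + t *\<^sub>R v)" "1 + \<bar>t\<bar>" M] by simp
    moreover have "- (t * (v \<bullet> g)) \<le> \<bar>t\<bar> * norm g"
      using abs_ge_minus_self[of "t * (v \<bullet> g)"] v
        mult_left_mono[OF Cauchy_Schwarz_ineq2[of v g], of "\<bar>t\<bar>"] by (simp add: abs_mult)
    moreover have "M + (M + norm g) * \<bar>t\<bar> \<le> C * t\<^sup>2"
    proof -
      have "1 \<le> \<bar>t\<bar> / e"
        using t e by simp
      moreover from this have "1 \<le> (\<bar>t\<bar> / e)\<^sup>2"
        by (simp add: one_le_power)
      ultimately have "M * 1 \<le> M * (\<bar>t\<bar> / e)\<^sup>2"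
        "(M + norm g) * \<bar>t\<bar> * 1 \<le> (M + norm g) * \<bar>t\<bar> * (\<bar>t\<bar> / e)"
        using M(1) by (intro mult_left_mono; simp)+
      then show ?thesis
        by (simp add: C_def power_divide algebra_simps add_divide_distrib power2_eq_square)
    qed
    moreover have "0 < \<gamma> n"
      using anisotropy_pos \<open>n \<noteq> 0\<close> .
    ultimately show ?thesis
      by (simp add: algebra_simps)
  qed
  have "0 \<le> C"
    using M e by (simp add: C_def)
  moreover have "(B + 1) * t\<^sup>2 \<le> max (B + 1) C * t\<^sup>2" "C * t\<^sup>2 \<le> max (B + 1) C * t\<^sup>2" for t
    by (auto intro: mult_right_mono)
  ultimately have "\<gamma> (n + t *\<^sub>R v) \<le> \<gamma> n + t * (v \<bullet> g) + max (B + 1) C * t\<^sup>2" for t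
    using near[of t] far[of t] by (meson add_left_mono le_less_linear order_trans)
  then show ?thesis
    using \<open>0 \<le> C\<close> by (intro exI[of _ "max (B + 1) C"]) (auto simp: g_def)
qed

text \<open>Rescaling the quadratic bound from \<open>\<alpha> = 1\<close> would produce
  \<open>\<beta>\<^sup>2 / \<alpha>\<close>, which degenerates as \<open>\<alpha>\<close> tends to
  0. A bound linear in \<open>\<bar>t\<bar>\<close> rescales uniformly and extends to
  \<open>\<alpha> = 0\<close>.\<close>

lemma anisotropy_first_order_bound:
  assumes n: "norm n = 1" and v: "norm v = 1"
  shows "\<exists>C\<ge>0. \<forall>\<alpha>\<ge>0. \<forall>\<beta>. \<gamma> (\<alpha> *\<^sub>R n + \<beta> *\<^sub>R v) \<le> \<alpha> * \<gamma> n + C * \<bar>\<beta>\<bar>"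
proof -
  obtain A where A: "0 \<le> A" "\<And>t. \<gamma> (n + t *\<^sub>R v) \<le> \<gamma> n + t * (v \<bullet> grad \<gamma> n) + A * t\<^sup>2"
    using anisotropy_second_order_bound[OF n v] by blast
  obtain M where M: "0 \<le> M" "\<And>p. \<gamma> p \<le> M * norm p"
    using anisotropy_linear_growth by blast
  define b where "b = \<bar>v \<bullet> grad \<gamma> n\<bar>"
  \<comment> \<open>For \<open>\<bar>t\<bar> \<le> 1\<close> the terms \<open>A\<close> and
    \<open>b\<close> suffice, because \<open>t\<^sup>2 \<le> \<bar>t\<bar>\<close>; for larger
    \<open>\<bar>t\<bar>\<close> linear growth needs \<open>2 * M\<close>.\<close>
  define C where "C = A + b + 2 * M"
  have "0 \<le> b"
    by (simp add: b_def)
  have "0 < \<gamma> n"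
    using anisotropy_pos[of n] n by fastforce
  have one: "\<gamma> (n + t *\<^sub>R v) \<le> \<gamma> n + C * \<bar>t\<bar>" for t
  proof (cases "\<bar>t\<bar> \<le> 1")
    case True
    have "t * (v \<bullet> grad \<gamma> n) \<le> b * \<bar>t\<bar>"
      using abs_ge_self[of "t * (v \<bullet> grad \<gamma> n)"] by (simp add: b_def abs_mult mult.commute)
    moreover have "A * t\<^sup>2 \<le> A * \<bar>t\<bar>"
      using True A(1) mult_left_mono[of "\<bar>t\<bar>" 1 "\<bar>t\<bar>"]
      by (intro mult_left_mono) (auto simp: power2_eq_square)
    moreover have "0 \<le> 2 * M * \<bar>t\<bar>"
      using M(1) by simp
    ultimately show ?thesis
      using A(2)[of t] by (simp add: C_def algebra_simps)
  next
    case False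
    have "\<gamma> (n + t *\<^sub>R v) \<le> M * (2 * \<bar>t\<bar>)"
      using M(2)[of "n + t *\<^sub>R v"] norm_triangle_ineq[of n "t *\<^sub>R v"] n v M(1) False
        mult_left_mono[of "norm (n + t *\<^sub>R v)" "2 * \<bar>t\<bar>" M] by simp
    moreover have "0 \<le> A * \<bar>t\<bar>" "0 \<le> b * \<bar>t\<bar>"
      using A(1) \<open>0 \<le> b\<close> by auto
    ultimately show ?thesis
      using \<open>0 < \<gamma> n\<close> by (simp add: C_def algebra_simps)
  qed
  have "\<gamma> (\<alpha> *\<^sub>R n + \<beta> *\<^sub>R v) \<le> \<alpha> * \<gamma> n + C * \<bar>\<beta>\<bar>" if "0 \<le> \<alpha>" for \<alpha> \<beta>
  proof (cases "\<alpha> = 0")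
    case True
    have "M * \<bar>\<beta>\<bar> \<le> C * \<bar>\<beta>\<bar>"
      using A(1) \<open>0 \<le> b\<close> M(1) by (intro mult_right_mono) (auto simp: C_def)
    then show ?thesis
      using M(2)[of "\<beta> *\<^sub>R v"] v True by simp
  next
    case False
    with that have "0 < \<alpha>"
      by simp
    then have "\<gamma> (\<alpha> *\<^sub>R n + \<beta> *\<^sub>R v) = \<alpha> * \<gamma> (n + (\<beta> / \<alpha>) *\<^sub>R v)"
      using anisotropy_homogeneous[of \<alpha> "n + (\<beta> / \<alpha>) *\<^sub>R v"] by (simp add: scaleR_add_right)
    also have "\<dots> \<le> \<alpha> * (\<gamma> n + C * \<bar>\<beta> / \<alpha>\<bar>)"
      by (rule mult_left_mono[OF one]) (use \<open>0 < \<alpha>\<close> in simp)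
    also have "\<dots> = \<alpha> * \<gamma> n + C * \<bar>\<beta>\<bar>"
      using \<open>0 < \<alpha>\<close> by (simp add: field_simps)
    finally show ?thesis .
  qed
  moreover have "0 \<le> C"
    using A(1) \<open>0 \<le> b\<close> M(1) by (simp add: C_def)
  ultimately show ?thesis
    by blast
qed

text \<open>
  In the orthonormal frame \<open>(perp n, n)\<close> with \<open>p = \<alpha> perp n + \<beta> n\<close>, the difference of the two sides
  is a quadratic polynomial minus \<open>\<gamma> (\<alpha> n - \<beta> perp n)\<close>, and \<open>k n\<close> only enters as \<open>k n * \<beta>\<^sup>2\<close>.
  For \<open>\<alpha> \<ge> 1/2\<close> the first-order parts at \<open>(1, 0)\<close> cancel; for \<open>\<alpha> \<le> 1/2\<close> the difference is
  positive at \<open>\<beta> = 0\<close>, and this is where \<open>\<gamma> (- n) < 3 * \<gamma> n\<close> is needed, the critical value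
  being \<open>\<alpha> = -1\<close>.
\<close>

lemma local_energy_estimate:
  assumes n: "norm n = 1" and three: "\<gamma> (- n) < 3 * \<gamma> n"
  shows "\<exists>K\<ge>0. \<forall>k p. K \<le> k n \<longrightarrow>
    \<gamma> (- perp p) - \<gamma> n \<le> (Zmat \<gamma> k n *v p) \<bullet> (p - perp n)"
proof -
  define \<tau> where "\<tau> = perp n"
  define G where "G = \<gamma> n"
  define b where "b = grad \<gamma> n \<bullet> \<tau>"
  have "n \<noteq> 0"
    using n by auto
  then have G: "0 < G"
    using anisotropy_pos by (simp add: G_def)
  \<comment> \<open>The direction is \<open>- \<tau>\<close> because rotating
    \<open>p = \<alpha> \<tau> + \<beta> n\<close> gives
    \<open>- perp p = \<alpha> n - \<beta> \<tau>\<close>.\<close>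
  have v: "norm (- \<tau>) = 1"
    using n by (simp add: \<tau>_def)
  obtain A where A: "0 \<le> A" "\<And>t. \<gamma> (n + t *\<^sub>R - \<tau>) \<le> G - t * b + A * t\<^sup>2"
    using anisotropy_second_order_bound[OF n v] by (auto simp: G_def b_def inner_commute)
  obtain C1 where C1: "0 \<le> C1"
    "\<And>\<alpha> \<beta>. 0 \<le> \<alpha> \<Longrightarrow> \<gamma> (\<alpha> *\<^sub>R n + \<beta> *\<^sub>R - \<tau>) \<le> \<alpha> * G + C1 * \<bar>\<beta>\<bar>"
    using anisotropy_first_order_bound[OF n v] by (auto simp: G_def)
  \<comment> \<open>The bound around \<open>- n\<close> serves negative \<open>\<alpha>\<close>,
    where \<open>- perp p\<close> lies in the opposite half-plane.\<close>
  obtain C2 where C2: "0 \<le> C2"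
    "\<And>\<alpha> \<beta>. 0 \<le> \<alpha> \<Longrightarrow> \<gamma> (\<alpha> *\<^sub>R - n + \<beta> *\<^sub>R - \<tau>) \<le> \<alpha> * \<gamma> (- n) + C2 * \<bar>\<beta>\<bar>"
    using anisotropy_first_order_bound[of "- n", OF _ v] n by auto
  define \<delta> where "\<delta> = 3 * G - \<gamma> (- n)"
  \<comment> \<open>Chosen so that
    \<open>c * (1 + a)\<^sup>2 \<le> G * (a - 1)\<^sup>2 + \<delta> * a\<close> for
    \<open>a \<ge> 0\<close>, in view of
    \<open>(1 + a)\<^sup>2 = (a - 1)\<^sup>2 + 4 * a\<close>.\<close>
  define c where "c = min G (\<delta> / 4)"
  have \<delta>: "0 < \<delta>"
    using three by (simp add: \<delta>_def G_def)
  then have c: "0 < c" "c \<le> G" "4 * c \<le> \<delta>"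
    using G by (auto simp: c_def)
  define E where "E = 2 * \<bar>b\<bar> + C2"
  \<comment> \<open>The summand \<open>G\<close> offsets the \<open>- G\<close> in the coefficient
    of \<open>\<beta>\<^sup>2\<close>. The other three are the multiples of
    \<open>\<beta>\<^sup>2\<close> required by the cases below, in their order.\<close>
  define K where "K = G + (2 * A + b\<^sup>2 / G) + (\<bar>b\<bar> + C1)\<^sup>2 / G + E\<^sup>2 / c"
  have terms: "0 \<le> b\<^sup>2 / G" "0 \<le> (\<bar>b\<bar> + C1)\<^sup>2 / G" "0 \<le> E\<^sup>2 / c"
    using G c by auto
  have poly: "\<gamma> (\<alpha> *\<^sub>R n + \<beta> *\<^sub>R - \<tau>) - G \<le> G * \<alpha> * (\<alpha> - 1) - b * \<beta> * (2 * \<alpha> - 1) + (\<kappa> - G) * \<beta>\<^sup>2"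
    (is "_ \<le> ?Q") if K: "K \<le> \<kappa>" for \<alpha> \<beta> \<kappa>
  proof -
    have mono: "x * \<beta>\<^sup>2 \<le> (\<kappa> - G) * \<beta>\<^sup>2" if "x \<le> \<kappa> - G" for x
      using that by (rule mult_right_mono) simp
    consider "1 / 2 \<le> \<alpha>" | "0 \<le> \<alpha>" "\<alpha> \<le> 1 / 2" | "\<alpha> < 0"
      by linarith
    then show ?thesis
    proof cases
      case 1
      have "\<gamma> (\<alpha> *\<^sub>R n + \<beta> *\<^sub>R - \<tau>) = \<alpha> * \<gamma> (n + (\<beta> / \<alpha>) *\<^sub>R - \<tau>)"
        using 1 anisotropy_homogeneous[of \<alpha> "n + (\<beta> / \<alpha>) *\<^sub>R - \<tau>"]
        by (simp add: scaleR_diff_right)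
      also have "\<dots> \<le> \<alpha> * (G - (\<beta> / \<alpha>) * b + A * (\<beta> / \<alpha>)\<^sup>2)"
        using A(2)[of "\<beta> / \<alpha>"] 1 by (intro mult_left_mono) auto
      also have "\<dots> = \<alpha> * G - \<beta> * b + A * \<beta>\<^sup>2 / \<alpha>"
        using 1 by (simp add: field_simps power2_eq_square)
      also have "A * \<beta>\<^sup>2 / \<alpha> \<le> A * \<beta>\<^sup>2 / (1 / 2)"
        using 1 A(1) by (intro divide_left_mono) auto
      finally have up: "\<gamma> (\<alpha> *\<^sub>R n + \<beta> *\<^sub>R - \<tau>) \<le> \<alpha> * G - \<beta> * b + 2 * A * \<beta>\<^sup>2"
        by simp
      \<comment> \<open>Subtracting \<open>up\<close> from the quadratic leaves \<open>G * (\<alpha>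
        - 1)\<^sup>2 - 2 * b * \<beta> * (\<alpha> - 1)\<close> plus multiples of
        \<open>\<beta>\<^sup>2\<close>; completing the square costs
        \<open>b\<^sup>2 / G * \<beta>\<^sup>2\<close>.\<close>
      have sq: "0 \<le> G * (\<alpha> - 1 - b * \<beta> / G)\<^sup>2"
        using G by simp
      have "G * (\<alpha> - 1 - b * \<beta> / G)\<^sup>2
          = G * (\<alpha> - 1)\<^sup>2 - 2 * b * \<beta> * (\<alpha> - 1) + b\<^sup>2 / G * \<beta>\<^sup>2"
        using G by (simp add: field_simps power2_eq_square)
      moreover have "(2 * A + b\<^sup>2 / G) * \<beta>\<^sup>2 \<le> (\<kappa> - G) * \<beta>\<^sup>2"
        by (rule mono) (use K terms in \<open>simp add: K_def\<close>)
      ultimately show ?thesis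
        using up sq by (simp add: algebra_simps power2_eq_square)
    next
      case 2
      \<comment> \<open>Here the gap at \<open>\<beta> = 0\<close> is
        \<open>G * (1 - \<alpha>)\<^sup>2\<close>, hence at least \<open>G / 4\<close>. It absorbs
        all terms linear in \<open>\<beta>\<close>, which are bounded by
        \<open>s * \<bar>\<beta>\<bar>\<close>.\<close>
      define s where "s = \<bar>b\<bar> + C1"
      have "b * \<beta> * (2 * \<alpha> - 1) \<le> \<bar>b\<bar> * \<bar>\<beta>\<bar>"
        using 2 abs_ge_self[of "b * \<beta> * (2 * \<alpha> - 1)"]
          mult_left_mono[of "\<bar>2 * \<alpha> - 1\<bar>" 1 "\<bar>b\<bar> * \<bar>\<beta>\<bar>"] by (simp add: abs_mult)
      moreover have "0 \<le> G * (1 / 2 - s / G * \<bar>\<beta>\<bar>)\<^sup>2"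
        using G by simp
      moreover have "G * (1 / 2 - s / G * \<bar>\<beta>\<bar>)\<^sup>2 = G / 4 - s * \<bar>\<beta>\<bar> + s\<^sup>2 / G * \<beta>\<^sup>2"
        using G by (simp add: power2_diff power_mult_distrib power_divide)
          (simp add: field_simps power2_eq_square)
      moreover have "s\<^sup>2 / G * \<beta>\<^sup>2 \<le> (\<kappa> - G) * \<beta>\<^sup>2"
        by (rule mono) (use K terms A in \<open>simp add: K_def s_def\<close>)
      moreover have "G * (1 / 2)\<^sup>2 \<le> G * (1 - \<alpha>)\<^sup>2"
        using 2 G by (intro mult_left_mono power_mono) auto
      ultimately show ?thesis
        using C1(2)[OF 2(1), of \<beta>] by (simp add: s_def algebra_simps power2_eq_square)
    next
      case 3
      \<comment> \<open>At \<open>\<beta> = 0\<close> the gap is at least \<open>G * (a\<^sup>2 + a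
        + 1) - a * \<gamma> (- n) = G * (a - 1)\<^sup>2 + \<delta> * a\<close>; positivity of
        \<open>\<delta>\<close> prevents it from degenerating at \<open>a = 1\<close>.\<close>
      define a where "a = - \<alpha>"
      have a: "0 \<le> a" "\<alpha> = - a"
        using 3 by (auto simp: a_def)
      have "- (b * \<beta> * (2 * a + 1)) \<le> \<bar>b\<bar> * \<bar>\<beta>\<bar> * (2 * a + 1)"
        using a abs_ge_minus_self[of "b * \<beta> * (2 * a + 1)"] by (simp add: abs_mult)
      also have "\<dots> \<le> \<bar>b\<bar> * \<bar>\<beta>\<bar> * (2 * (1 + a))"
        using a by (intro mult_left_mono) auto
      also have "\<dots> = 2 * \<bar>b\<bar> * \<bar>\<beta>\<bar> * (1 + a)"
        by (simp only: ac_simps)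
      finally have "- (b * \<beta> * (2 * a + 1)) \<le> 2 * \<bar>b\<bar> * \<bar>\<beta>\<bar> * (1 + a)" .
      moreover have "C2 * \<bar>\<beta>\<bar> \<le> C2 * \<bar>\<beta>\<bar> * (1 + a)"
        using a C2(1) by (simp add: algebra_simps)
      ultimately have lin: "C2 * \<bar>\<beta>\<bar> - b * \<beta> * (2 * a + 1) \<le> E * \<bar>\<beta>\<bar> * (1 + a)"
        by (simp add: E_def algebra_simps)
      \<comment> \<open>Young's inequality with weight \<open>c\<close> splits the mixed term into a
        part controlled by the gap and a multiple of \<open>\<beta>\<^sup>2\<close>.\<close>
      have "2 * (c * (1 + a)) * (E * \<bar>\<beta>\<bar>) \<le> (c * (1 + a))\<^sup>2 + (E * \<bar>\<beta>\<bar>)\<^sup>2"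
        by (rule sum_squares_bound)
      moreover have "0 \<le> (c * (1 + a)) * (E * \<bar>\<beta>\<bar>)"
        using c a C2(1) by (simp add: E_def)
      ultimately have "c * ((1 + a) * (E * \<bar>\<beta>\<bar>)) \<le> c * (c * (1 + a)\<^sup>2) + E\<^sup>2 * \<beta>\<^sup>2"
        by (simp add: power_mult_distrib power2_eq_square algebra_simps)
      then have young: "E * \<bar>\<beta>\<bar> * (1 + a) \<le> c * (1 + a)\<^sup>2 + E\<^sup>2 / c * \<beta>\<^sup>2"
        using c by (simp add: field_simps power2_eq_square)
      have "c * (a - 1)\<^sup>2 \<le> G * (a - 1)\<^sup>2" "4 * c * a \<le> \<delta> * a"
        using c a by (auto intro: mult_right_mono)
      then have coer: "c * (1 + a)\<^sup>2 \<le> G * (a - 1)\<^sup>2 + \<delta> * a"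
        by (simp add: algebra_simps power2_eq_square)
      have "E\<^sup>2 / c * \<beta>\<^sup>2 \<le> (\<kappa> - G) * \<beta>\<^sup>2"
        by (rule mono) (use K terms A in \<open>simp add: K_def\<close>)
      moreover have "\<gamma> (\<alpha> *\<^sub>R n + \<beta> *\<^sub>R - \<tau>) \<le> a * \<gamma> (- n) + C2 * \<bar>\<beta>\<bar>"
        using C2(2)[OF a(1), of \<beta>] a(2) by simp
      ultimately show ?thesis
        using lin young coer by (simp add: a(2) \<delta>_def algebra_simps power2_eq_square)
    qed
  qed
  have "\<gamma> (- perp p) - \<gamma> n \<le> (Zmat \<gamma> k n *v p) \<bullet> (p - perp n)" if "K \<le> k n" for k p
  proof -
    define \<alpha> where "\<alpha> = p \<bullet> \<tau>"
    define \<beta> where "\<beta> = p \<bullet> n"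
    have p: "p = \<alpha> *\<^sub>R \<tau> + \<beta> *\<^sub>R n"
      using orthonormal_expansion[OF n] by (simp add: \<alpha>_def \<beta>_def \<tau>_def)
    have q: "- perp p = \<alpha> *\<^sub>R n + \<beta> *\<^sub>R - \<tau>"
      by (simp add: p perp_add perp_scaleR \<tau>_def)
    have on: "n \<bullet> n = 1" "\<tau> \<bullet> \<tau> = 1" "n \<bullet> \<tau> = 0" "\<tau> \<bullet> n = 0"
      using n v by (simp_all add: \<tau>_def flip: norm_eq_1)
    have gr: "grad \<gamma> n \<bullet> n = G" "n \<bullet> grad \<gamma> n = G" "grad \<gamma> n \<bullet> \<tau> = b" "\<tau> \<bullet> grad \<gamma> n = b"
      using anisotropy_euler[OF \<open>n \<noteq> 0\<close>] by (simp_all add: G_def b_def inner_commute)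
    \<comment> \<open>By Euler's identity the two gradient terms contribute \<open>- 2 * G\<close>
      to the coefficient of \<open>\<beta>\<^sup>2\<close>, which therefore becomes
      \<open>k n - G\<close>.\<close>
    have "(Zmat \<gamma> k n *v p) \<bullet> (p - \<tau>)
        = G * \<alpha> * (\<alpha> - 1) - b * \<beta> * (2 * \<alpha> - 1) + (k n - G) * \<beta>\<^sup>2"
      unfolding Zmat_mult p
      by (simp add: inner_add_left inner_add_right inner_diff_left inner_diff_right on gr
          G_def[symmetric] algebra_simps power2_eq_square)
    then show ?thesis
      using poly[OF that, of \<alpha> \<beta>] by (simp only: q G_def \<tau>_def)
  qed
  moreover have "0 \<le> K"
    using terms A G by (simp add: K_def)
  ultimately show ?thesis
    by blast
qed

text \<open>Both sides are homogeneous of degree one under joint scaling of \<open>x\<close> and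
  \<open>y\<close>. Dividing by \<open>norm x\<close> turns \<open>x\<close> into
  \<open>perp n\<close> and \<open>y\<close> into an arbitrary vector \<open>p\<close>, which is the
  situation of the assumed estimate.\<close>

lemma element_energy_estimate:
  assumes K: "\<And>p. \<gamma> (- perp p) - \<gamma> n \<le> (Zmat \<gamma> k n *v p) \<bullet> (p - perp n)"
    and x: "x \<noteq> 0" and n: "n = - (perp x /\<^sub>R norm x)"
  shows "\<gamma> (- perp y) - \<gamma> (- perp x)
    \<le> (Zmat \<gamma> k n *v y) \<bullet> (inverse (norm x) *\<^sub>R (y - x))"
proof -
  define s where "s = norm x"
  have s: "0 < s"
    using x by (simp add: s_def)
  define p where "p = y /\<^sub>R s"
  have y: "y = s *\<^sub>R p" "- perp y = s *\<^sub>R (- perp p)"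
    using s by (simp_all add: p_def perp_scaleR)
  have x': "x = s *\<^sub>R perp n" "- perp x = s *\<^sub>R n"
    using s x by (simp_all add: n s_def perp_minus perp_scaleR)
  have "\<gamma> (- perp y) - \<gamma> (- perp x) = s * (\<gamma> (- perp p) - \<gamma> n)"
    by (simp only: y(2) x'(2) anisotropy_homogeneous[OF s] right_diff_distrib)
  also have "\<dots> \<le> s * ((Zmat \<gamma> k n *v p) \<bullet> (p - perp n))"
    using K s by (intro mult_left_mono) auto
  also have "\<dots> = (Zmat \<gamma> k n *v y) \<bullet> (p - perp n)"
    by (simp add: y(1) matrix_vector_mult_scaleR)
  also have "p - perp n = inverse (norm x) *\<^sub>R (y - x)"
  proof -
    have "y - x = s *\<^sub>R (p - perp n)"
      using y(1) x'(1) by (metis scaleR_right_diff_distrib)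
    then show ?thesis
      using s x by (simp add: s_def)
  qed
  finally show ?thesis .
qed

end

subsection \<open>Finite elements\<close>

lemma node_mono: "node N i \<le> node N j" if "i \<le> j"
  using that by (simp add: node_def divide_right_mono)

lemma Vh_derivative:
  assumes "v \<in> Vh N" "j \<in> {1..N}"
  shows "\<exists>d. \<forall>\<rho>\<in>{node N (j - 1)<..<node N j}. (v has_vector_derivative d) (at \<rho>)"
proof -
  obtain a b where ab: "\<forall>\<rho>\<in>{node N (j - 1)..node N j}. v \<rho> = a + b * \<rho>"
    using assms unfolding Vh_def by blast
  have "(v has_vector_derivative b) (at \<rho>)" if "\<rho> \<in> {node N (j - 1)<..<node N j}" for \<rho>
  proof (rule has_vector_derivative_transform_within_open)
    show "((\<lambda>\<rho>. a + b * \<rho>) has_vector_derivative b) (at \<rho>)"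
      by (auto intro!: derivative_eq_intros)
    show "open {node N (j - 1)<..<node N j}" "\<rho> \<in> {node N (j - 1)<..<node N j}"
      using that by auto
    show "a + b * x = v x" if "x \<in> {node N (j - 1)<..<node N j}" for x
      using that ab by simp
  qed
  then show ?thesis
    by blast
qed

lemma Vh2_derivative:
  assumes "v \<in> Vh2 N" "j \<in> {1..N}"
  shows "\<exists>d. \<forall>\<rho>\<in>{node N (j - 1)<..<node N j}. (v has_vector_derivative d) (at \<rho>)"
proof -
  have "\<forall>i. \<exists>d. \<forall>\<rho>\<in>{node N (j - 1)<..<node N j}. ((\<lambda>\<rho>. v \<rho> $ i) has_vector_derivative d) (at \<rho>)"
    using assms by (auto simp: Vh2_def intro!: Vh_derivative[simplified])
  then obtain d where d: "\<And>i \<rho>. \<rho> \<in> {node N (j - 1)<..<node N j} \<Longrightarrow>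
      ((\<lambda>\<rho>. v \<rho> $ i) has_vector_derivative d i) (at \<rho>)"
    by metis
  have "(v has_vector_derivative (\<chi> i. d i)) (at \<rho>)"
    if "\<rho> \<in> {node N (j - 1)<..<node N j}" for \<rho>
    using d[OF that] unfolding has_vector_derivative_def
    by (subst has_derivative_componentwise_within) (auto simp: Basis_vec_def inner_axis)
  then show ?thesis
    by blast
qed

text \<open>Only open elements are constrained, since the derivative of a finite element function is
  unspecified at the nodes. The notion is stable under arbitrary pointwise operations, so
  integrability needs no continuity of the integrands.\<close>

definition elementwise_const :: "nat \<Rightarrow> (real \<Rightarrow> 'a) \<Rightarrow> bool" where
  "elementwise_const N f \<longleftrightarrow>
     (\<forall>j\<in>{1..N}. \<exists>c. \<forall>\<rho>\<in>{node N (j - 1)<..<node N j}. f \<rho> = c)"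

lemma elementwise_const_comp:
  "elementwise_const N f \<Longrightarrow> elementwise_const N (\<lambda>\<rho>. F (f \<rho>))"
  unfolding elementwise_const_def by metis

lemma elementwise_const_comp2:
  "elementwise_const N f \<Longrightarrow> elementwise_const N g \<Longrightarrow> elementwise_const N (\<lambda>\<rho>. F (f \<rho>) (g \<rho>))"
  unfolding elementwise_const_def by metis

lemma elementwise_const_deriv_Vh: "v \<in> Vh N \<Longrightarrow> elementwise_const N (D\<rho> v)"
  unfolding elementwise_const_def using Vh_derivative vector_derivative_at by meson

lemma elementwise_const_deriv_Vh2: "v \<in> Vh2 N \<Longrightarrow> elementwise_const N (D\<rho> v)"
  unfolding elementwise_const_def using Vh2_derivative vector_derivative_at by meson

text \<open>Induction over the nodes: each element adds its constant value times its length, and the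
  values at the two end nodes form a null set.\<close>

lemma elementwise_const_integral:
  fixes f :: "real \<Rightarrow> real"
  assumes "elementwise_const N f" "1 \<le> N"
  shows "f integrable_on {0..1}"
    and "(\<And>j \<rho>. j \<in> {1..N} \<Longrightarrow> \<rho> \<in> {node N (j - 1)<..<node N j} \<Longrightarrow> 0 \<le> f \<rho>) \<Longrightarrow>
      0 \<le> integral {0..1} f"
proof -
  have "f integrable_on {0..node N i} \<and>
    ((\<forall>j\<in>{1..N}. \<forall>\<rho>\<in>{node N (j - 1)<..<node N j}. 0 \<le> f \<rho>) \<longrightarrow> 0 \<le> integral {0..node N i} f)"
    if "i \<le> N" for i
    using that
  proof (induction i)
    case 0
    show ?case
      using integrable_on_refl[of f 0] by (simp add: node_def)
  next
    case (Suc i)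
    have le: "0 \<le> node N i" "node N i \<le> node N (Suc i)"
      using node_mono[of i "Suc i"] by (auto simp: node_def)
    have j: "Suc i \<in> {1..N}"
      using Suc.prems by simp
    obtain c where c: "\<And>\<rho>. \<rho> \<in> {node N i<..<node N (Suc i)} \<Longrightarrow> f \<rho> = c"
      using assms(1) j unfolding elementwise_const_def by fastforce
    have int: "(f has_integral c * (node N (Suc i) - node N i)) {node N i..node N (Suc i)}"
    proof (rule has_integral_spike_finite[of "{node N i, node N (Suc i)}"])
      show "((\<lambda>_. c) has_integral c * (node N (Suc i) - node N i)) {node N i..node N (Suc i)}"
        using has_integral_const_real[of c "node N i" "node N (Suc i)"] le
        by (simp add: mult.commute)
    qed (auto intro!: c)
    \<comment> \<open>Elements have positive length, so \<open>c\<close> is attained at an interior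
      point and inherits the sign of \<open>f\<close>.\<close>
    have "0 \<le> c" if "\<forall>j\<in>{1..N}. \<forall>\<rho>\<in>{node N (j - 1)<..<node N j}. 0 \<le> f \<rho>"
    proof -
      have "node N i < node N (Suc i)"
        using assms(2) by (simp add: node_def divide_strict_right_mono)
      then obtain \<rho> where "\<rho> \<in> {node N i<..<node N (Suc i)}"
        using dense by auto
      then show ?thesis
        using c that j by fastforce
    qed
    moreover have "f integrable_on {0..node N (Suc i)}"
      "integral {0..node N (Suc i)} f = integral {0..node N i} f + c * (node N (Suc i) - node N i)"
      using Suc.IH Suc.prems int has_integral_combine[OF le _ int]
      by (auto simp: integrable_integral has_integral_iff)
    ultimately show ?case
      using Suc.IH Suc.prems le by auto
  qed
  from this[of N] show "f integrable_on {0..1}"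
    "(\<And>j \<rho>. j \<in> {1..N} \<Longrightarrow> \<rho> \<in> {node N (j - 1)<..<node N j} \<Longrightarrow> 0 \<le> f \<rho>) \<Longrightarrow>
      0 \<le> integral {0..1} f"
    using assms(2) by (auto simp: node_def)
qed

text \<open>The element estimate holds at every interior point of every element; integrating the
  nonnegative difference of its two sides gives the claim.\<close>

lemma discrete_energy_estimate:
  assumes aniso: "anisotropy \<gamma>" and N: "1 \<le> N"
    and X: "X \<in> Vh2 N" "X' \<in> Vh2 N" and nd: "nondegenerate N X"
    and K: "\<And>n p. norm n = 1 \<Longrightarrow> \<gamma> (- perp p) - \<gamma> n \<le> (Zmat \<gamma> k n *v p) \<bullet> (p - perp n)"
  shows "integral {0..1} (\<lambda>\<rho>. \<gamma> (- perp (D\<rho> X' \<rho>))) - integral {0..1} (\<lambda>\<rho>. \<gamma> (- perp (D\<rho> X \<rho>)))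
    \<le> ip (\<lambda>\<rho>. Zmat \<gamma> k (nvec X \<rho>) *v D\<rho> X' \<rho>)
         (\<lambda>\<rho>. inverse (norm (D\<rho> X \<rho>)) *\<^sub>R D\<rho> (\<lambda>\<rho>. X' \<rho> - X \<rho>) \<rho>)"
proof -
  have der: "D\<rho> (\<lambda>\<rho>. X' \<rho> - X \<rho>) \<rho> = D\<rho> X' \<rho> - D\<rho> X \<rho>"
    if j: "j \<in> {1..N}" and \<rho>: "\<rho> \<in> {node N (j - 1)<..<node N j}" for j \<rho>
  proof -
    obtain d d' where d: "(X has_vector_derivative d) (at \<rho>)" "(X' has_vector_derivative d') (at \<rho>)"
      using Vh2_derivative[OF X(1) j] Vh2_derivative[OF X(2) j] \<rho> by blast
    then show ?thesis
      using has_vector_derivative_diff[OF d(2,1)] by (simp add: vector_derivative_at)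
  qed
  have cX: "elementwise_const N (D\<rho> X)" "elementwise_const N (D\<rho> X')"
    using X by (auto intro: elementwise_const_deriv_Vh2)
  have cD: "elementwise_const N (D\<rho> (\<lambda>\<rho>. X' \<rho> - X \<rho>))"
  proof -
    have "elementwise_const N (\<lambda>\<rho>. D\<rho> X' \<rho> - D\<rho> X \<rho>)"
      by (rule elementwise_const_comp2[OF cX(2,1)])
    then show ?thesis
      by (simp add: elementwise_const_def der)
  qed
  define f where "f = (\<lambda>\<rho>. (Zmat \<gamma> k (nvec X \<rho>) *v D\<rho> X' \<rho>) \<bullet>
      (inverse (norm (D\<rho> X \<rho>)) *\<^sub>R D\<rho> (\<lambda>\<rho>. X' \<rho> - X \<rho>) \<rho>))"
  define g where "g = (\<lambda>\<rho>. \<gamma> (- perp (D\<rho> X \<rho>)))"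
  define g' where "g' = (\<lambda>\<rho>. \<gamma> (- perp (D\<rho> X' \<rho>)))"
  have "elementwise_const N (nvec X)"
    unfolding nvec_def[abs_def] by (rule elementwise_const_comp[OF cX(1)])
  then have "elementwise_const N (\<lambda>\<rho>. Zmat \<gamma> k (nvec X \<rho>) *v D\<rho> X' \<rho>)"
    by (rule elementwise_const_comp2[OF _ cX(2), where F = "\<lambda>n y. Zmat \<gamma> k n *v y"])
  moreover have "elementwise_const N (\<lambda>\<rho>. inverse (norm (D\<rho> X \<rho>)) *\<^sub>R D\<rho> (\<lambda>\<rho>. X' \<rho> - X \<rho>) \<rho>)"
    by (rule elementwise_const_comp2[OF cX(1) cD, where F = "\<lambda>x d. inverse (norm x) *\<^sub>R d"])
  ultimately have cf: "elementwise_const N f"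
    unfolding f_def by (rule elementwise_const_comp2)
  have cg: "elementwise_const N g" "elementwise_const N g'"
    unfolding g_def g'_def
    by (rule elementwise_const_comp[OF cX(1)] elementwise_const_comp[OF cX(2)])+
  have "elementwise_const N (\<lambda>\<rho>. f \<rho> - (g' \<rho> - g \<rho>))"
    by (rule elementwise_const_comp2[OF cf elementwise_const_comp2[OF cg(2,1)]])
  then have "0 \<le> integral {0..1} (\<lambda>\<rho>. f \<rho> - (g' \<rho> - g \<rho>))"
  proof (rule elementwise_const_integral(2)[OF _ N])
    fix j \<rho> assume j: "j \<in> {1..N}" "\<rho> \<in> {node N (j - 1)<..<node N j}"
    have x: "D\<rho> X \<rho> \<noteq> 0"
      using nd j unfolding nondegenerate_def by fastforce
    then have "norm (nvec X \<rho>) = 1"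
      by (simp add: nvec_def)
    from element_energy_estimate[OF aniso K[OF this] x nvec_def]
    show "0 \<le> f \<rho> - (g' \<rho> - g \<rho>)"
      using der[OF j] by (simp add: f_def g_def g'_def)
  qed
  then show ?thesis
    using elementwise_const_integral(1)[OF _ N] cf cg
    by (simp add: integral_diff integrable_diff ip_def f_def g_def g'_def)
qed

section \<open>Contact points and the energy balance of one time step\<close>

text \<open>The normalization of \<open>Gvec\<close> is made for this: paired with the chord between
  the contact points, it returns the exact arclength increment, so the contact line terms cancel
  without error.\<close>

lemma Gvec_inner:
  assumes "r c' \<noteq> r c"
  shows "Gvec r c c' \<bullet> (r c' - r c) = c' - c"
proof -
  have "(r c' - r c) \<bullet> (r c' - r c) = (norm (r c' - r c))\<^sup>2"
    by (simp add: power2_norm_eq_inner)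
  then show ?thesis
    using assms by (simp add: Gvec_def)
qed

text \<open>The first equation is tested with \<open>\<mu>'\<close> and the second with the
  displacement \<open>\<zeta>\<close>. Eliminating the shared term \<open>A\<close> leaves an
  identity whose right-hand side has the sign given by the discrete energy estimate.\<close>

lemma energy_dissipation:
  assumes "anisotropy \<gamma>" "1 \<le> N" "0 < \<eta>" "0 < \<Delta>t"
    and X: "X \<in> Sh N r cl cr" and "nondegenerate N X"
    and step: "scheme_step \<gamma> k \<sigma> \<eta> \<Delta>t L r N X cl cr X' \<mu>' cl' cr'"
    and K: "\<And>n p. norm n = 1 \<Longrightarrow> \<gamma> (- perp p) - \<gamma> n \<le> (Zmat \<gamma> k n *v p) \<bullet> (p - perp n)"
  shows "(energy \<gamma> \<sigma> X' cl' cr' - energy \<gamma> \<sigma> X cl cr) / \<Delta>t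
    + ip (\<lambda>\<rho>. \<bar>D\<rho> \<mu>' \<rho>\<bar>\<^sup>2) (\<lambda>\<rho>. inverse (norm (D\<rho> X \<rho>)))
    + 1 / \<eta> * (((cr' - cr) / \<Delta>t)\<^sup>2 + ((cl' - cl) / \<Delta>t)\<^sup>2) \<le> 0"
proof -
  define \<zeta> where "\<zeta> = (\<lambda>\<rho>. X' \<rho> - X \<rho>)"
  define A where "A = iph N (\<lambda>\<rho>. (X' \<rho> - X \<rho>) \<bullet> nvec_half X X' \<rho>) (\<lambda>\<rho>. \<mu>' \<rho> * norm (D\<rho> X \<rho>))"
  define B where "B = ip (\<lambda>\<rho>. Zmat \<gamma> k (nvec X \<rho>) *v D\<rho> X' \<rho>)
      (\<lambda>\<rho>. inverse (norm (D\<rho> X \<rho>)) *\<^sub>R D\<rho> \<zeta> \<rho>)"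
  define P where "P = ip (\<lambda>\<rho>. \<bar>D\<rho> \<mu>' \<rho>\<bar>\<^sup>2) (\<lambda>\<rho>. inverse (norm (D\<rho> X \<rho>)))"
  define I where "I = integral {0..1} (\<lambda>\<rho>. \<gamma> (- perp (D\<rho> X \<rho>)))"
  define I' where "I' = integral {0..1} (\<lambda>\<rho>. \<gamma> (- perp (D\<rho> X' \<rho>)))"
  note s = step[unfolded scheme_step_def]
  have ne: "r cl' \<noteq> r cl" "r cr' \<noteq> r cr"
    using s by auto
  have "P = ip (D\<rho> \<mu>') (\<lambda>\<rho>. D\<rho> \<mu>' \<rho> * inverse (norm (D\<rho> X \<rho>)))"
    by (simp add: P_def ip_def power2_eq_square mult.assoc)
  then have first: "1 / \<Delta>t * A + P = 0"
    using s by (simp add: A_def)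
  \<comment> \<open>The two lumped products have pointwise equal integrands, so the one-sided limits
    agree whatever their values.\<close>
  have A: "A = iph N (\<lambda>\<rho>. \<mu>' \<rho> *\<^sub>R nvec_half X X' \<rho>) (\<lambda>\<rho>. norm (D\<rho> X \<rho>) *\<^sub>R \<zeta> \<rho>)"
    by (simp add: A_def iph_def \<zeta>_def inner_commute ac_simps)
  have ends: "\<zeta> 0 = r cl' - r cl" "\<zeta> 1 = r cr' - r cr"
    using X s by (auto simp: \<zeta>_def Sh_def)
  have "\<zeta> \<in> Vtest N r cl cr cl' cr'"
    using s by (simp add: \<zeta>_def)
  then have "A - B + \<sigma> * (Gvec r cr cr' \<bullet> \<zeta> 1 - Gvec r cl cl' \<bullet> \<zeta> 0)
        - 1 / (\<eta> * \<Delta>t) *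
            ((cr' - cr) * (Gvec r cr cr' \<bullet> \<zeta> 1) + (cl' - cl) * (Gvec r cl cl' \<bullet> \<zeta> 0)) = 0"
    unfolding A B_def using s by blast
  then have second: "A = B - \<sigma> * ((cr' - cr) - (cl' - cl))
      + 1 / (\<eta> * \<Delta>t) * ((cr' - cr)\<^sup>2 + (cl' - cl)\<^sup>2)"
    by (simp add: ends Gvec_inner[OF ne(1)] Gvec_inner[OF ne(2)] power2_eq_square)
  have "X \<in> Vh2 N" "X' \<in> Vh2 N"
    using X s by (auto simp: Sh_def)
  then have "I' - I \<le> B"
    unfolding I_def I'_def B_def \<zeta>_def using assms by (intro discrete_energy_estimate)
  moreover have "(energy \<gamma> \<sigma> X' cl' cr' - energy \<gamma> \<sigma> X cl cr) / \<Delta>t + P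
      + 1 / \<eta> * (((cr' - cr) / \<Delta>t)\<^sup>2 + ((cl' - cl) / \<Delta>t)\<^sup>2) = (I' - I - B) / \<Delta>t"
  \<comment> \<open>The substrate energy \<open>S\<close> and the contact line dissipation in
    \<open>Q\<close> both reappear in \<open>A\<close> through the second equation and
    cancel.\<close>
  proof -
    define Q where "Q = (cr' - cr)\<^sup>2 + (cl' - cl)\<^sup>2"
    define S where "S = \<sigma> * ((cr' - cr) - (cl' - cl))"
    have P: "P = - (A / \<Delta>t)"
      using first by simp
    have "energy \<gamma> \<sigma> X' cl' cr' - energy \<gamma> \<sigma> X cl cr = I' - I - S"
      by (simp add: energy_def I_def I'_def S_def algebra_simps)
    moreover have "1 / \<eta> * (((cr' - cr) / \<Delta>t)\<^sup>2 + ((cl' - cl) / \<Delta>t)\<^sup>2)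
        = 1 / (\<eta> * \<Delta>t) * Q / \<Delta>t"
      by (simp add: Q_def power_divide add_divide_distrib[symmetric] power2_eq_square)
    moreover have "A = B - S + 1 / (\<eta> * \<Delta>t) * Q"
      using second by (simp add: S_def Q_def)
    ultimately show ?thesis
      unfolding P by (simp add: add_divide_distrib diff_divide_distrib)
  qed
  ultimately show ?thesis
    using \<open>0 < \<Delta>t\<close> by (simp add: P_def divide_le_0_iff)
qed

theorem theorem4p1:
  fixes \<gamma> :: "real^2 \<Rightarrow> real"
  assumes "anisotropy \<gamma>"
    and "\<forall>n\<in>sphere 0 1. \<gamma> (- n) < 3 * \<gamma> n"
  shows "\<exists>k0 :: real^2 \<Rightarrow> real. (\<forall>n\<in>sphere 0 1. 0 \<le> k0 n) \<and>
    (\<forall>(k :: real^2 \<Rightarrow> real) (\<sigma> :: real) (\<eta> :: real) (\<Delta>t :: real) (L :: real)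
      (r :: real \<Rightarrow> real^2) (N :: nat) (K :: nat)
      (X :: nat \<Rightarrow> real \<Rightarrow> real^2) (\<mu> :: nat \<Rightarrow> real \<Rightarrow> real) (cl :: nat \<Rightarrow> real) (cr :: nat \<Rightarrow> real).
      (\<forall>n\<in>sphere 0 1. k0 n \<le> k n) \<and> 0 < \<eta> \<and> 0 < \<Delta>t \<and> 1 \<le> N \<and> substrate L r \<and>
      scheme_solution \<gamma> k \<sigma> \<eta> \<Delta>t L r N K X \<mu> cl cr \<longrightarrow>
      (\<forall>m<K.
        (energy \<gamma> \<sigma> (X (Suc m)) (cl (Suc m)) (cr (Suc m)) - energy \<gamma> \<sigma> (X m) (cl m) (cr m)) / \<Delta>t
        + ip (\<lambda>\<rho>. \<bar>D\<rho> (\<mu> (Suc m)) \<rho>\<bar>\<^sup>2) (\<lambda>\<rho>. inverse (norm (D\<rho> (X m) \<rho>)))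
        + 1 / \<eta> * (((cr (Suc m) - cr m) / \<Delta>t)\<^sup>2 + ((cl (Suc m) - cl m) / \<Delta>t)\<^sup>2) \<le> 0) \<and>
      (\<forall>i j. i \<le> j \<and> j \<le> K \<longrightarrow>
        energy \<gamma> \<sigma> (X j) (cl j) (cr j) \<le> energy \<gamma> \<sigma> (X i) (cl i) (cr i)))"
proof -
  \<comment> \<open>The threshold precedes the quantifier over \<open>k\<close>, so choosing it for
    each \<open>n\<close> gives a \<open>k0\<close> fixed before \<open>k\<close> and all
    discretization data.\<close>
  have "\<forall>n\<in>sphere 0 1. \<exists>K\<ge>0. \<forall>k p. K \<le> k n \<longrightarrow>
      \<gamma> (- perp p) - \<gamma> n \<le> (Zmat \<gamma> k n *v p) \<bullet> (p - perp n)"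
    using assms local_energy_estimate by simp
  then obtain k0 where k0: "\<forall>n\<in>sphere 0 1. 0 \<le> k0 n"
    "\<And>n k p. \<lbrakk>n \<in> sphere 0 1; k0 n \<le> k n\<rbrakk> \<Longrightarrow>
      \<gamma> (- perp p) - \<gamma> n \<le> (Zmat \<gamma> k n *v p) \<bullet> (p - perp n)"
    by metis
  show ?thesis
  proof (rule exI[of _ k0], rule conjI[OF k0(1)], intro allI impI, elim conjE)
    fix k :: "real^2 \<Rightarrow> real" and \<sigma> \<eta> \<Delta>t L :: real and r :: "real \<Rightarrow> real^2" and N K :: nat
      and X :: "nat \<Rightarrow> real \<Rightarrow> real^2" and \<mu> :: "nat \<Rightarrow> real \<Rightarrow> real" and cl cr :: "nat \<Rightarrow> real"
    assume k: "\<forall>n\<in>sphere 0 1. k0 n \<le> k n" and pos: "0 < \<eta>" "0 < \<Delta>t" and N: "1 \<le> N"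
      and sol: "scheme_solution \<gamma> k \<sigma> \<eta> \<Delta>t L r N K X \<mu> cl cr"
    let ?W = "\<lambda>m. energy \<gamma> \<sigma> (X m) (cl m) (cr m)"
    let ?P = "\<lambda>m. ip (\<lambda>\<rho>. \<bar>D\<rho> (\<mu> (Suc m)) \<rho>\<bar>\<^sup>2) (\<lambda>\<rho>. inverse (norm (D\<rho> (X m) \<rho>)))"
    let ?Q = "\<lambda>m. 1 / \<eta> * (((cr (Suc m) - cr m) / \<Delta>t)\<^sup>2 + ((cl (Suc m) - cl m) / \<Delta>t)\<^sup>2)"
    have step: "nondegenerate N (X m)" "scheme_step \<gamma> k \<sigma> \<eta> \<Delta>t L r N (X m) (cl m) (cr m)
          (X (Suc m)) (\<mu> (Suc m)) (cl (Suc m)) (cr (Suc m))" if "m < K" for m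
      using sol that by (auto simp: scheme_solution_def)
    \<comment> \<open>Membership comes from the initial data for \<open>m = 0\<close> and otherwise
      from the preceding time step.\<close>
    have Sh: "X m \<in> Sh N r (cl m) (cr m)" if "m \<le> K" for m
    proof (cases m)
      case 0
      then show ?thesis
        using sol by (simp add: scheme_solution_def)
    next
      case (Suc i)
      then show ?thesis
        using step(2)[of i] that by (simp add: scheme_step_def)
    qed
    have diss: "(?W (Suc m) - ?W m) / \<Delta>t + ?P m + ?Q m \<le> 0" if "m < K" for m
      by (rule energy_dissipation[OF assms(1) N pos Sh step])
        (use that k k0(2) in auto)
    have decr: "?W (Suc m) \<le> ?W m" if "m < K" for m
    proof -
      have "\<mu> (Suc m) \<in> Vh N" "X m \<in> Vh2 N"
        using step(2)[OF that] Sh[of m] that by (auto simp: scheme_step_def Sh_def)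
      then have "elementwise_const N (D\<rho> (\<mu> (Suc m)))" "elementwise_const N (D\<rho> (X m))"
        by (auto intro: elementwise_const_deriv_Vh elementwise_const_deriv_Vh2)
      then have "elementwise_const N (\<lambda>\<rho>. \<bar>D\<rho> (\<mu> (Suc m)) \<rho>\<bar>\<^sup>2 \<bullet> inverse (norm (D\<rho> (X m) \<rho>)))"
        by (rule elementwise_const_comp2[where F = "\<lambda>d x. \<bar>d\<bar>\<^sup>2 \<bullet> inverse (norm x)"])
      then have "0 \<le> ?P m"
        unfolding ip_def by (rule elementwise_const_integral(2)[OF _ N]) simp
      moreover have "0 \<le> ?Q m"
        using pos by simp
      ultimately show ?thesis
        using diss[OF that] pos by (smt (verit) divide_pos_pos)
    qed
    have "?W j \<le> ?W i" if "i \<le> j" "j \<le> K" for i j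
      using that
    proof (induction j rule: dec_induct)
      case (step j)
      then show ?case
        using decr[of j] by simp
    qed simp
    then show "(\<forall>m<K. (?W (Suc m) - ?W m) / \<Delta>t + ?P m + ?Q m \<le> 0) \<and>
        (\<forall>i j. i \<le> j \<and> j \<le> K \<longrightarrow> ?W j \<le> ?W i)"
      using diss by blast
  qed
qed

end
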